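(* For $u\in[0,2]$ let $f_u$ be the density on $[0,1]$ given by $$f_u(\eta)=\begin{cases}u-4(u-1)\eta, & \eta\le \tfrac12,\\ 4-3u+4(u-1)\eta, & \eta>\tfrac12,\end{cases}$$ and suppose $\eta_s$ has density $f_u$. In the unconstrained economy (short selling allowed), if $0<c<\frac{(1-\alpha)p}{(1-\alpha)+4\alpha(1-p)}$, then the likelihood of a very low price, $P(q<c)$, is increasing in the perceived variance of $\eta_s$: writing $P_u(q<c)$ and $\mathrm{Var}_u(\eta_s)$ for the probability and variance when $\eta_s$ has density $f_u$, for all $u_1,u_2\in[0,2]$ with $\mathrm{Var}_{u_1}(\eta_s)<\mathrm{Var}_{u_2}(\eta_s)$ one has $P_{u_1}(q<c)<P_{u_2}(q<c)$.
   Context: Parameters: $p,\alpha\in(0,1)$, $g\in(0,1]$. The asset value $V$ is Bernoulli with $P(V=1)=p$, $P(V=0)=1-p$. The random variable $\eta_s\in[0,1]$ is independent of $V$; it is known to the market maker, but the regulator knows only its density. One trader arrives. With probability $1-g$ he is inactive (no trade). With probability $g$ he is active; an active trader is informed with probability $\alpha$ and noise with probability $1-\alpha$. An active informed trader buys if $V=1$ and sells (or shorts) if $V=0$. An active noise trader sells (or shorts) with probability $\eta_s$ and buys with probability $1-\eta_s$, independently of $V$. Thus, given $\eta_s$, $P(Sell\mid\eta_s)=g(1-\alpha)\eta_s+g\alpha(1-p)$, $P(Buy\mid\eta_s)=g(1-\alpha)(1-\eta_s)+g\alpha p$, $P(\text{No Trade}\mid\eta_s)=1-g$. The price $q$ is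 the market maker's expectation of $V$ given $\eta_s$ and the observed action: $q=Bid=\frac{(1-\alpha)\eta_s p}{(1-\alpha)\eta_s+\alpha(1-p)}$ after a sell, $q=Ask=\frac{(1-\alpha)(1-\eta_s)p+\alpha p}{(1-\alpha)(1-\eta_s)+\alpha p}$ after a buy, and $q=p$ after no trade. $P(q<c)$ is the probability under the joint law of $\eta_s$ and the action. *)

theory Defs
  imports "HOL-Probability.Probability"
begin

datatype action = Buy | Sell | No_Trade

text \<open>
  The joint law of the event \<open>V = 1\<close> and the observed action, for a known value \<open>\<eta>\<close> of \<open>\<eta>\<^sub>s\<close>.
  The prior of \<open>V\<close> does not depend on \<open>\<eta>\<close>, which expresses the independence of \<open>V\<close> and \<open>\<eta>\<^sub>s\<close>.
  Short sales are unconstrained, so sales and short sales are the same action.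
\<close>

definition trade_pmf :: "real \<Rightarrow> real \<Rightarrow> real \<Rightarrow> real \<Rightarrow> (bool \<times> action) pmf" where
  "trade_pmf p \<alpha> g \<eta> =
     do { v \<leftarrow> bernoulli_pmf p;
          active \<leftarrow> bernoulli_pmf g;
          informed \<leftarrow> bernoulli_pmf \<alpha>;
          noise_sells \<leftarrow> bernoulli_pmf \<eta>;
          return_pmf (v,
            if \<not> active then No_Trade
            else if informed then (if v then Buy else Sell)
            else (if noise_sells then Sell else Buy)) }"

definition action_pmf :: "real \<Rightarrow> real \<Rightarrow> real \<Rightarrow> real \<Rightarrow> action pmf" where
  "action_pmf p \<alpha> g \<eta> = map_pmf snd (trade_pmf p \<alpha> g \<eta>)"

text \<open>
  The market maker's expectation of \<open>V\<close> given \<open>\<eta>\<^sub>s = \<eta>\<close> and the action \<open>a\<close>.  An action of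
  probability zero (only \<open>No_Trade\<close>, and only for \<open>g = 1\<close>) leaves the prior expectation \<open>p\<close>.
\<close>

definition price :: "real \<Rightarrow> real \<Rightarrow> real \<Rightarrow> real \<Rightarrow> action \<Rightarrow> real" where
  "price p \<alpha> g \<eta> a =
     (if a \<in> set_pmf (action_pmf p \<alpha> g \<eta>)
      then measure_pmf.expectation (cond_pmf (trade_pmf p \<alpha> g \<eta>) {x. snd x = a})
             (\<lambda>x. of_bool (fst x))
      else p)"

definition eta_density :: "real \<Rightarrow> real \<Rightarrow> real" where
  "eta_density u \<eta> = (if \<eta> \<le> 1/2 then u - 4 * (u - 1) * \<eta> else 4 - 3 * u + 4 * (u - 1) * \<eta>)"

definition eta_law :: "real \<Rightarrow> real measure" where
  "eta_law u = density lborel (\<lambda>\<eta>. ennreal (eta_density u \<eta> * indicator {0..1} \<eta>))"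

definition eta_variance :: "real \<Rightarrow> real" where
  "eta_variance u = prob_space.variance (eta_law u) (\<lambda>\<eta>. \<eta>)"

definition eta_action_law :: "real \<Rightarrow> real \<Rightarrow> real \<Rightarrow> real \<Rightarrow> (real \<times> action) measure" where
  "eta_action_law p \<alpha> g u =
     eta_law u \<bind> (\<lambda>\<eta>. distr (measure_pmf (action_pmf p \<alpha> g \<eta>))
                          (borel \<Otimes>\<^sub>M count_space UNIV) (\<lambda>a. (\<eta>, a)))"

definition prob_price_below :: "real \<Rightarrow> real \<Rightarrow> real \<Rightarrow> real \<Rightarrow> real \<Rightarrow> real" where
  "prob_price_below p \<alpha> g u c =
     measure (eta_action_law p \<alpha> g u) {(\<eta>, a). price p \<alpha> g \<eta> a < c}"

lemma UNIV_action: "(UNIV :: action set) = {Buy, Sell, No_Trade}"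
  using action.exhaust by auto

lemma finite_action [simp]: "finite (A :: action set)"
  by (rule finite_subset[OF subset_UNIV]) (simp add: UNIV_action)

lemma pmf_trade:
  assumes "0 \<le> p" "p \<le> 1" "0 \<le> \<alpha>" "\<alpha> \<le> 1" "0 \<le> g" "g \<le> 1" "0 \<le> \<eta>" "\<eta> \<le> 1"
  shows "pmf (trade_pmf p \<alpha> g \<eta>) (v, a) =
    (if v then p else 1 - p) *
    (case a of No_Trade \<Rightarrow> 1 - g
     | Sell \<Rightarrow> g * ((if v then 0 else \<alpha>) + (1 - \<alpha>) * \<eta>)
     | Buy \<Rightarrow> g * ((if v then \<alpha> else 0) + (1 - \<alpha>) * (1 - \<eta>)))"
  using assms by (cases a; cases v)
    (simp_all add: trade_pmf_def pmf_bind indicator_def algebra_simps)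

lemma pmf_action:
  "pmf (action_pmf p \<alpha> g \<eta>) a = pmf (trade_pmf p \<alpha> g \<eta>) (True, a) + pmf (trade_pmf p \<alpha> g \<eta>) (False, a)"
proof -
  have "snd -` {a} = {(True, a), (False, a)}"
    by (auto intro: prod_eqI)
  then show ?thesis
    by (simp add: action_pmf_def pmf_map measure_measure_pmf_finite)
qed

lemma pmf_action_formulas:
  assumes "0 \<le> p" "p \<le> 1" "0 \<le> \<alpha>" "\<alpha> \<le> 1" "0 \<le> g" "g \<le> 1" "0 \<le> \<eta>" "\<eta> \<le> 1"
  shows "pmf (action_pmf p \<alpha> g \<eta>) Sell = g * (1 - \<alpha>) * \<eta> + g * \<alpha> * (1 - p)"
    and "pmf (action_pmf p \<alpha> g \<eta>) Buy = g * (1 - \<alpha>) * (1 - \<eta>) + g * \<alpha> * p"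
    and "pmf (action_pmf p \<alpha> g \<eta>) No_Trade = 1 - g"
  using assms by (simp_all add: pmf_action pmf_trade algebra_simps)

lemma price_eq:
  "price p \<alpha> g \<eta> a =
     (if pmf (action_pmf p \<alpha> g \<eta>) a \<noteq> 0
      then pmf (trade_pmf p \<alpha> g \<eta>) (True, a) / pmf (action_pmf p \<alpha> g \<eta>) a else p)"
proof (cases "a \<in> set_pmf (action_pmf p \<alpha> g \<eta>)")
  case True
  let ?T = "trade_pmf p \<alpha> g \<eta>" and ?S = "{x. snd x = a} :: (bool \<times> action) set"
  have S: "?S = {(True, a), (False, a)}"
    by (auto intro: prod_eqI)
  have ne: "set_pmf ?T \<inter> ?S \<noteq> {}"
    using True by (auto simp: action_pmf_def)
  have "measure ?T ?S = pmf (action_pmf p \<alpha> g \<eta>) a"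
    by (simp add: S pmf_action measure_measure_pmf_finite)
  moreover have "measure_pmf.expectation (cond_pmf ?T ?S) (\<lambda>x. of_bool (fst x) :: real) =
    pmf (cond_pmf ?T ?S) (True, a)"
    by (subst integral_measure_pmf_real[where A = "{(True, a), (False, a)}"])
       (use ne S in \<open>auto simp: set_cond_pmf\<close>)
  ultimately show ?thesis
    using True by (simp add: price_def pmf_cond[OF ne] set_pmf_iff)
qed (simp add: price_def set_pmf_iff)

lemma price_formulas:
  assumes "0 < p" "p < 1" "0 < \<alpha>" "\<alpha> < 1" "0 < g" "g \<le> 1" "0 \<le> \<eta>" "\<eta> \<le> 1"
  shows "price p \<alpha> g \<eta> Sell = (1 - \<alpha>) * \<eta> * p / ((1 - \<alpha>) * \<eta> + \<alpha> * (1 - p))" (is ?S)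
    and "price p \<alpha> g \<eta> Buy =
           ((1 - \<alpha>) * (1 - \<eta>) * p + \<alpha> * p) / ((1 - \<alpha>) * (1 - \<eta>) + \<alpha> * p)" (is ?B)
    and "price p \<alpha> g \<eta> No_Trade = p" (is ?N)
proof -
  have s: "(1 - \<alpha>) * \<eta> + \<alpha> * (1 - p) > 0" and b: "(1 - \<alpha>) * (1 - \<eta>) + \<alpha> * p > 0"
    using assms by (auto intro!: add_nonneg_pos)
  have S: "pmf (action_pmf p \<alpha> g \<eta>) Sell = g * ((1 - \<alpha>) * \<eta> + \<alpha> * (1 - p))"
    and B: "pmf (action_pmf p \<alpha> g \<eta>) Buy = g * ((1 - \<alpha>) * (1 - \<eta>) + \<alpha> * p)"
    and N: "pmf (action_pmf p \<alpha> g \<eta>) No_Trade = 1 - g"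
    using assms by (simp_all add: pmf_action_formulas algebra_simps)
  have S': "pmf (trade_pmf p \<alpha> g \<eta>) (True, Sell) = g * ((1 - \<alpha>) * \<eta> * p)"
    and B': "pmf (trade_pmf p \<alpha> g \<eta>) (True, Buy) = g * ((1 - \<alpha>) * (1 - \<eta>) * p + \<alpha> * p)"
    and N': "pmf (trade_pmf p \<alpha> g \<eta>) (True, No_Trade) = p * (1 - g)"
    using assms by (simp_all add: pmf_trade algebra_simps)
  show ?S unfolding price_eq S S' using s assms by simp
  show ?B unfolding price_eq B B' using b assms by simp
  show ?N unfolding price_eq N N' by simp
qed

lemma eta_density_nonneg:
  assumes "0 \<le> u" "u \<le> 2" "0 \<le> \<eta>" "\<eta> \<le> 1"
  shows "0 \<le> eta_density u \<eta>"
proof (cases "\<eta> \<le> 1/2")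
  case True
  then have "eta_density u \<eta> = u * (1 - 2 * \<eta>) + (2 - u) * (2 * \<eta>)"
    by (simp add: eta_density_def algebra_simps)
  then show ?thesis using assms True by simp
next
  case False
  then have "eta_density u \<eta> = u * (2 * \<eta> - 1) + (2 - u) * (2 - 2 * \<eta>)"
    by (simp add: eta_density_def algebra_simps)
  then show ?thesis using assms False by simp
qed

lemma measurable_eta_density [measurable]: "eta_density u \<in> borel_measurable borel"
  unfolding eta_density_def[abs_def] by measurable

lemma sets_eta_law [measurable_cong, simp]: "sets (eta_law u) = sets borel"
  by (simp add: eta_law_def)

lemma space_eta_law [simp]: "space (eta_law u) = UNIV"
  by (simp add: eta_law_def)

lemma prob_space_eta_law:
  assumes "0 \<le> u" "u \<le> 2"
  shows "prob_space (eta_law u)"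
proof
  let ?f1 = "\<lambda>x. u - 4 * (u - 1) * x" and ?f2 = "\<lambda>x. 4 - 3 * u + 4 * (u - 1) * x"
  let ?F1 = "\<lambda>x::real. u * x - 2 * (u - 1) * x^2"
  let ?F2 = "\<lambda>x::real. (4 - 3 * u) * x + 2 * (u - 1) * x^2"
  have nn1: "0 \<le> ?f1 x" if "x \<in> {0..1/2}" for x
    using eta_density_nonneg[of u x] assms that by (simp add: eta_density_def)
  have nn2: "0 \<le> ?f2 x" if "1/2 < x" "x \<le> 1" for x
    using eta_density_nonneg[of u x] assms that by (simp add: eta_density_def)
  have nn2': "0 \<le> ?f2 x" if "x \<in> {1/2..1}" for x
  proof (cases "x = 1/2")
    case True
    then have "?f2 x = 2 - u"
      by (simp only: True) (simp add: algebra_simps)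
    then show ?thesis using assms by simp
  next
    case False
    then show ?thesis using nn2[of x] that by simp
  qed
  have "emeasure (eta_law u) (space (eta_law u)) =
    (\<integral>\<^sup>+x. ennreal (eta_density u x * indicator {0..1} x) \<partial>lborel)"
    unfolding eta_law_def by (subst emeasure_density) simp_all
  also have "\<dots> = (\<integral>\<^sup>+x. ennreal (?f1 x) * indicator {0..1/2} x +
                        ennreal (?f2 x) * indicator {1/2..1} x \<partial>lborel)"
  proof (rule nn_integral_cong_AE, rule AE_mp[OF AE_lborel_singleton[of "1/2 :: real"]],
      intro AE_I2 impI)
    fix x :: real
    assume "x \<noteq> 1/2"
    then consider "x < 0" | "0 \<le> x" "x < 1/2" | "1/2 < x" "x \<le> 1" | "1 < x"
      by linarith
    then show "ennreal (eta_density u x * indicator {0..1} x) =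
      ennreal (?f1 x) * indicator {0..1/2} x + ennreal (?f2 x) * indicator {1/2..1} x"
      by cases (simp_all add: eta_density_def)
  qed
  also have "\<dots> = (\<integral>\<^sup>+x. ennreal (?f1 x) * indicator {0..1/2} x \<partial>lborel) +
                   (\<integral>\<^sup>+x. ennreal (?f2 x) * indicator {1/2..1} x \<partial>lborel)"
    by (intro nn_integral_add) auto
  also have "(\<integral>\<^sup>+x. ennreal (?f1 x) * indicator {0..1/2} x \<partial>lborel) = ennreal (?F1 (1/2) - ?F1 0)"
    by (rule nn_integral_FTC_Icc) (simp, force intro!: derivative_eq_intros, rule nn1, simp_all)
  also have "(\<integral>\<^sup>+x. ennreal (?f2 x) * indicator {1/2..1} x \<partial>lborel) = ennreal (?F2 1 - ?F2 (1/2))"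
    by (rule nn_integral_FTC_Icc) (simp, force intro!: derivative_eq_intros, rule nn2', simp_all)
  also have "ennreal (?F1 (1/2) - ?F1 0) + ennreal (?F2 1 - ?F2 (1/2)) = ennreal 1"
    by (subst ennreal_plus[symmetric]) (auto simp: power2_eq_square field_simps)
  finally show "emeasure (eta_law u) (space (eta_law u)) = 1"
    by simp
qed

lemma bernoulli_pmf_clamp: "bernoulli_pmf \<eta> = bernoulli_pmf (min 1 (max 0 \<eta>))"
  by (rule pmf_eqI) (simp add: bernoulli_pmf.rep_eq)

lemma trade_pmf_clamp: "trade_pmf p \<alpha> g \<eta> = trade_pmf p \<alpha> g (min 1 (max 0 \<eta>))"
  unfolding trade_pmf_def by (subst bernoulli_pmf_clamp[of \<eta>]) (rule refl)

lemma measurable_pmf_trade [measurable]: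
  assumes "0 \<le> p" "p \<le> 1" "0 \<le> \<alpha>" "\<alpha> \<le> 1" "0 \<le> g" "g \<le> 1"
  shows "(\<lambda>\<eta>. pmf (trade_pmf p \<alpha> g \<eta>) x) \<in> borel_measurable borel"
proof -
  obtain v a where x: "x = (v, a)" by (cases x)
  show ?thesis
    unfolding x
    by (subst trade_pmf_clamp, subst pmf_trade) (use assms in \<open>cases a; simp\<close>)+
qed

lemma measurable_pmf_action:
  assumes "0 \<le> p" "p \<le> 1" "0 \<le> \<alpha>" "\<alpha> \<le> 1" "0 \<le> g" "g \<le> 1"
  shows "(\<lambda>\<eta>. pmf (action_pmf p \<alpha> g \<eta>) a) \<in> borel_measurable borel"
  unfolding pmf_action using assms by measurable

lemma measurable_action_pmf:
  assumes "0 \<le> p" "p \<le> 1" "0 \<le> \<alpha>" "\<alpha> \<le> 1" "0 \<le> g" "g \<le> 1"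
  shows "(\<lambda>\<eta>. measure_pmf (action_pmf p \<alpha> g \<eta>)) \<in> borel \<rightarrow>\<^sub>M subprob_algebra (count_space UNIV)"
proof (rule measurable_subprob_algebra)
  fix A :: "action set"
  have "emeasure (action_pmf p \<alpha> g \<eta>) A = ennreal (\<Sum>a\<in>A. pmf (action_pmf p \<alpha> g \<eta>) a)" for \<eta>
    by (simp add: measure_pmf.emeasure_eq_measure measure_measure_pmf_finite)
  moreover have "(\<lambda>\<eta>. ennreal (\<Sum>a\<in>A. pmf (action_pmf p \<alpha> g \<eta>) a)) \<in> borel_measurable borel"
    using measurable_pmf_action[OF assms] by measurable
  ultimately show "(\<lambda>\<eta>. emeasure (action_pmf p \<alpha> g \<eta>) A) \<in> borel_measurable borel"
    by simp
qed (auto intro: prob_space_imp_subprob_space measure_pmf.prob_space_axioms)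

lemma measurable_eta_action_kernel:
  assumes "0 \<le> p" "p \<le> 1" "0 \<le> \<alpha>" "\<alpha> \<le> 1" "0 \<le> g" "g \<le> 1"
  shows "(\<lambda>\<eta>. distr (measure_pmf (action_pmf p \<alpha> g \<eta>)) (borel \<Otimes>\<^sub>M count_space UNIV) (\<lambda>a. (\<eta>, a)))
    \<in> borel \<rightarrow>\<^sub>M subprob_algebra (borel \<Otimes>\<^sub>M count_space UNIV)"
  by (rule measurable_distr2[OF _ measurable_action_pmf[OF assms]]) simp

lemma prob_space_eta_action_law:
  assumes "0 \<le> p" "p \<le> 1" "0 \<le> \<alpha>" "\<alpha> \<le> 1" "0 \<le> g" "g \<le> 1" "0 \<le> u" "u \<le> 2"
  shows "prob_space (eta_action_law p \<alpha> g u)"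
proof -
  interpret prob_space "eta_law u" using assms by (intro prob_space_eta_law)
  show ?thesis
    unfolding eta_action_law_def
  proof (rule prob_space_bind)
    show "(\<lambda>\<eta>. distr (measure_pmf (action_pmf p \<alpha> g \<eta>)) (borel \<Otimes>\<^sub>M count_space UNIV) (\<lambda>a. (\<eta>, a)))
      \<in> eta_law u \<rightarrow>\<^sub>M subprob_algebra (borel \<Otimes>\<^sub>M count_space UNIV)"
      using measurable_eta_action_kernel[of p \<alpha> g] assms by (simp cong: measurable_cong_sets)
  qed (intro AE_I2 measure_pmf.prob_space_distr; simp add: space_pair_measure)
qed

lemma price_event_sets:
  assumes "0 \<le> p" "p \<le> 1" "0 \<le> \<alpha>" "\<alpha> \<le> 1" "0 \<le> g" "g \<le> 1"
  shows "{(\<eta>, a). price p \<alpha> g \<eta> a < c} \<in> sets (borel \<Otimes>\<^sub>M count_space UNIV)"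
proof -
  have "(\<lambda>\<eta>. price p \<alpha> g \<eta> a) \<in> borel_measurable borel" for a
    unfolding price_eq
    using measurable_pmf_action[OF assms] measurable_pmf_trade[OF assms] by measurable
  then have "{\<eta>. price p \<alpha> g \<eta> a < c} \<times> {a} \<in> sets (borel \<Otimes>\<^sub>M count_space UNIV)" for a
    by (intro pair_measureI) auto
  then have "(\<Union>a\<in>UNIV. {\<eta>. price p \<alpha> g \<eta> a < c} \<times> {a}) \<in> sets (borel \<Otimes>\<^sub>M count_space UNIV)"
    by (intro sets.finite_UN) auto
  also have "(\<Union>a\<in>UNIV. {\<eta>. price p \<alpha> g \<eta> a < c} \<times> {a}) = {(\<eta>, a). price p \<alpha> g \<eta> a < c}"
    by auto
  finally show ?thesis .
qed

end

theory Submission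
  imports Defs
begin

text \<open>
  A price below \<open>c\<close> occurs only after a sale, and exactly when \<open>\<eta>\<^sub>s\<close> lies below the threshold \<open>t\<close> at
  which the bid equals \<open>c\<close>. The bound on \<open>c\<close> is the bid at \<open>\<eta>\<^sub>s = 1/4\<close>, so \<open>t < 1/4\<close>. There the
  density \<open>f\<^sub>u(\<eta>) = u - 4(u - 1)\<eta>\<close> has \<open>u\<close>-derivative \<open>1 - 4\<eta> > 0\<close>, so the probability is strictly
  increasing in \<open>u\<close>. So is the variance, which equals \<open>(1 + u)/24\<close>.
\<close>

text \<open>The density is linear on each side of 1/2, so the integral splits there and each half
  follows from an antiderivative, \<open>G\<close> or \<open>H\<close>. The lemma serves to compute
  the mean and the variance.\<close>

lemma has_bochner_integral_eta_law:
  fixes \<phi> G H :: "real \<Rightarrow> real"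
  assumes u: "0 \<le> u" "u \<le> 2" and \<phi>: "\<And>x. isCont \<phi> x"
    and G: "\<And>x. DERIV G x :> (u - 4 * (u - 1) * x) * \<phi> x"
    and H: "\<And>x. DERIV H x :> (4 - 3 * u + 4 * (u - 1) * x) * \<phi> x"
  shows "has_bochner_integral (eta_law u) \<phi> (G (1/2) - G 0 + (H 1 - H (1/2)))"
proof -
  have [measurable]: "\<phi> \<in> borel_measurable borel"
    using \<phi> by (intro borel_measurable_continuous_onI continuous_at_imp_continuous_on) auto
  let ?f = "\<lambda>x. (u - 4 * (u - 1) * x) * \<phi> x * indicator {0..1/2} x +
                 (4 - 3 * u + 4 * (u - 1) * x) * \<phi> x * indicator {1/2..1} x"
  have "has_bochner_integral lborel ?f (G (1/2) - G 0 + (H 1 - H (1/2)))"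
    by (intro has_bochner_integral_add has_bochner_integral_FTC_Icc_real G H continuous_intros \<phi>) auto
  \<comment> \<open>The closed intervals overlap at 1/2, where \<open>?f\<close> counts both
    branches; that point is a null set.\<close>
  moreover have "AE x in lborel. ?f x = (eta_density u x * indicator {0..1} x) *\<^sub>R \<phi> x"
    by (rule AE_mp[OF AE_lborel_singleton[of "1/2 :: real"]], intro AE_I2 impI)
      (auto simp: eta_density_def indicator_def)
  ultimately have "has_bochner_integral lborel
      (\<lambda>x. (eta_density u x * indicator {0..1} x) *\<^sub>R \<phi> x) (G (1/2) - G 0 + (H 1 - H (1/2)))"
    by (subst has_bochner_integral_cong_AE[symmetric, where f = ?f]) auto
  then show ?thesis
    unfolding eta_law_def
    by (intro has_bochner_integral_density)
       (auto simp: indicator_def intro: eta_density_nonneg u)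
qed

text \<open>This strictly increasing closed form turns a comparison of variances into a comparison
  of the parameters \<open>u\<close>.\<close>

lemma eta_variance_eq:
  assumes "0 \<le> u" "u \<le> 2"
  shows "eta_variance u = (1 + u) / 24"
proof -
  have "has_bochner_integral (eta_law u) (\<lambda>x. x)
     ((\<lambda>x. u * x^2 / 2 - 4 * (u - 1) * x^3 / 3) (1/2) - (\<lambda>x. u * x^2 / 2 - 4 * (u - 1) * x^3 / 3) 0 +
      ((\<lambda>x. (4 - 3 * u) * x^2 / 2 + 4 * (u - 1) * x^3 / 3) 1 -
       (\<lambda>x. (4 - 3 * u) * x^2 / 2 + 4 * (u - 1) * x^3 / 3) (1/2)))"
    by (rule has_bochner_integral_eta_law[OF assms])
       (auto intro!: derivative_eq_intros simp: power2_eq_square field_simps)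
  then have mean: "(\<integral>x. x \<partial>eta_law u) = 1/2"
    by (auto dest!: has_bochner_integral_integral_eq simp: field_simps power2_eq_square power3_eq_cube)
  \<comment> \<open>The two brackets are antiderivatives of \<open>(x - 1/2)^2\<close> and of
    \<open>x * (x - 1/2)^2\<close>.\<close>
  let ?G = "\<lambda>x. u * (x^3/3 - x^2/2 + x/4) - 4 * (u - 1) * (x^4/4 - x^3/3 + x^2/8)"
  let ?H = "\<lambda>x. (4 - 3 * u) * (x^3/3 - x^2/2 + x/4) + 4 * (u - 1) * (x^4/4 - x^3/3 + x^2/8)"
  have "has_bochner_integral (eta_law u) (\<lambda>x. (x - 1/2)\<^sup>2) (?G (1/2) - ?G 0 + (?H 1 - ?H (1/2)))"
    by (rule has_bochner_integral_eta_law[OF assms])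
       (auto intro!: derivative_eq_intros simp: power2_eq_square power3_eq_cube field_simps)
  then have "(\<integral>x. (x - 1/2)\<^sup>2 \<partial>eta_law u) = ?G (1/2) - ?G 0 + (?H 1 - ?H (1/2))"
    by (rule has_bochner_integral_integral_eq)
  also have "\<dots> = (1 + u) / 24"
    by (simp add: field_simps power2_eq_square power3_eq_cube power4_eq_xxxx)
  finally show ?thesis
    by (simp add: eta_variance_def mean)
qed

text \<open>A buy or no trade leaves the price at least \<open>p\<close>, which exceeds
  \<open>c\<close>. For a sale, clearing the positive denominator turns bid < \<open>c\<close> into
  a linear inequality in \<eta> with coefficient \<open>(1 - \<alpha>) * (p - c)\<close>, positive
  because \<open>c < p\<close>.\<close>

lemma low_price_actions:
  assumes "0 < p" "p < 1" "0 < \<alpha>" "\<alpha> < 1" "0 < g" "g \<le> 1" "0 \<le> \<eta>" "\<eta> \<le> 1" "c < p"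
  shows "{a. price p \<alpha> g \<eta> a < c} =
    (if \<eta> < c * \<alpha> * (1 - p) / ((1 - \<alpha>) * (p - c)) then {Sell} else {})"
proof -
  have s: "(1 - \<alpha>) * \<eta> + \<alpha> * (1 - p) > 0" and b: "(1 - \<alpha>) * (1 - \<eta>) + \<alpha> * p > 0"
    using assms by (auto intro!: add_nonneg_pos)
  have "price p \<alpha> g \<eta> Sell < c \<longleftrightarrow> \<eta> < c * \<alpha> * (1 - p) / ((1 - \<alpha>) * (p - c))"
  proof -
    have "0 < (1 - \<alpha>) * (p - c)"
      using assms by simp
    with s show ?thesis
      using assms by (simp only: price_formulas pos_divide_less_eq pos_less_divide_eq)
        (simp add: algebra_simps)
  qed
  \<comment> \<open>Clearing the denominator in \<open>p\<close> \<le> ask leaves exactly this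
    inequality.\<close>
  moreover have "\<alpha> * p * p \<le> \<alpha> * p"
    using assms by (simp add: mult_left_le)
  then have "p \<le> price p \<alpha> g \<eta> Buy"
    using b assms by (simp add: price_formulas pos_le_divide_eq algebra_simps)
  moreover have "price p \<alpha> g \<eta> No_Trade = p"
    using assms by (simp add: price_formulas)
  ultimately have "price p \<alpha> g \<eta> a < c \<longleftrightarrow>
      a = Sell \<and> \<eta> < c * \<alpha> * (1 - p) / ((1 - \<alpha>) * (p - c))" for a
    using \<open>c < p\<close> by (cases a) auto
  then show ?thesis by auto
qed

text \<open>Disintegration of the joint law: the kernel at \<eta> lives on the fibre over \<eta>, so
  only the section of \<open>A\<close> there counts.\<close>

lemma emeasure_eta_action_law:
  assumes "0 \<le> p" "p \<le> 1" "0 \<le> \<alpha>" "\<alpha> \<le> 1" "0 \<le> g" "g \<le> 1"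
    and A: "A \<in> sets (borel \<Otimes>\<^sub>M count_space UNIV)"
  shows "emeasure (eta_action_law p \<alpha> g u) A =
    (\<integral>\<^sup>+\<eta>. emeasure (action_pmf p \<alpha> g \<eta>) {a. (\<eta>, a) \<in> A} \<partial>eta_law u)"
proof -
  have "emeasure (eta_action_law p \<alpha> g u) A =
    (\<integral>\<^sup>+\<eta>. emeasure (distr (measure_pmf (action_pmf p \<alpha> g \<eta>))
        (borel \<Otimes>\<^sub>M count_space UNIV) (\<lambda>a. (\<eta>, a))) A \<partial>eta_law u)"
    unfolding eta_action_law_def
    by (rule emeasure_bind[OF _ _ A])
       (use measurable_eta_action_kernel[of p \<alpha> g] assms in \<open>simp_all cong: measurable_cong_sets\<close>)
  also have "\<dots> = (\<integral>\<^sup>+\<eta>. emeasure (action_pmf p \<alpha> g \<eta>) {a. (\<eta>, a) \<in> A} \<partial>eta_law u)"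
    using A by (intro nn_integral_cong) (subst emeasure_distr, simp_all add: vimage_def space_pair_measure)
  finally show ?thesis .
qed

text \<open>The probability is the integral over \<open>[0, t]\<close> of the sell probability times
  the density. Since \<open>t \<le> 1/2\<close>, only the first branch of the density enters, and
  the result is one polynomial in \<open>t\<close>, affine in \<open>u\<close>.\<close>

lemma prob_price_below_eq:
  assumes *: "0 < p" "p < 1" "0 < \<alpha>" "\<alpha> < 1" "0 < g" "g \<le> 1" "0 \<le> u" "u \<le> 2"
    and c: "c < p" and t: "t = c * \<alpha> * (1 - p) / ((1 - \<alpha>) * (p - c))" "0 \<le> t" "t \<le> 1/2"
  shows "prob_price_below p \<alpha> g u c =
    g * (\<alpha> * (1 - p) * (u * t - 2 * (u - 1) * t^2) + (1 - \<alpha>) * (u / 2 * t^2 - 4/3 * (u - 1) * t^3))"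
proof -
  \<comment> \<open>\<open>h\<close> is the sell probability times the first branch of the density;
    \<open>H\<close> is its antiderivative vanishing at 0.\<close>
  define h where "h x = g * (\<alpha> * (1 - p) + (1 - \<alpha>) * x) * (u - 4 * (u - 1) * x)" for x
  define H where "H x = g * (\<alpha> * (1 - p) * (u * x - 2 * (u - 1) * x^2) +
      (1 - \<alpha>) * (u / 2 * x^2 - 4/3 * (u - 1) * x^3))" for x
  have dens: "0 \<le> u - 4 * (u - 1) * x" if "0 \<le> x" "x \<le> t" for x
    using eta_density_nonneg[of u x] that t * by (simp add: eta_density_def)
  have h_nonneg: "0 \<le> h x" if "0 \<le> x" "x \<le> t" for x
    unfolding h_def using that * by (intro mult_nonneg_nonneg dens) auto
  have H_deriv: "DERIV H x :> h x" for x
  proof -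
    have "DERIV (\<lambda>x. g * (a * (u * x - 2 * (u - 1) * x^2) + b * (u / 2 * x^2 - 4/3 * (u - 1) * x^3))) x
        :> g * (a + b * x) * (u - 4 * (u - 1) * x)" for a b
      by (auto intro!: derivative_eq_intros simp: power2_eq_square field_simps)
    then show ?thesis
      unfolding h_def H_def .
  qed
  \<comment> \<open>This makes \<open>H t - H 0\<close> nonnegative, so that it survives the passage
    from \<open>ennreal\<close> back to reals.\<close>
  have H_mono: "H 0 \<le> H t"
    by (rule DERIV_nonneg_imp_nondecreasing[OF t(2)]) (use h_nonneg H_deriv in blast)
  define e where "e \<eta> = emeasure (action_pmf p \<alpha> g \<eta>) {a. price p \<alpha> g \<eta> a < c}" for \<eta>
  have e: "e \<eta> = ennreal (g * (\<alpha> * (1 - p) + (1 - \<alpha>) * \<eta>) * indicator {..<t} \<eta>)"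
    if "0 \<le> \<eta>" "\<eta> \<le> 1" for \<eta>
  proof -
    have "{a. price p \<alpha> g \<eta> a < c} = (if \<eta> < t then {Sell} else {})"
      unfolding t(1) using that * c by (intro low_price_actions)
    moreover have "pmf (action_pmf p \<alpha> g \<eta>) Sell = g * (\<alpha> * (1 - p) + (1 - \<alpha>) * \<eta>)"
      using that * by (simp add: pmf_action_formulas algebra_simps)
    ultimately show ?thesis
      by (simp add: e_def emeasure_pmf_single)
  qed
  have "emeasure (eta_action_law p \<alpha> g u) {(\<eta>, a). price p \<alpha> g \<eta> a < c} = (\<integral>\<^sup>+\<eta>. e \<eta> \<partial>eta_law u)"
    using * by (subst emeasure_eta_action_law) (auto intro!: price_event_sets simp: e_def[abs_def])
  also have "\<dots> = (\<integral>\<^sup>+\<eta>. ennreal (g * (\<alpha> * (1 - p) + (1 - \<alpha>) * \<eta>) * indicator {..<t} \<eta>) \<partial>eta_law u)"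
  \<comment> \<open>The formula for \<open>e\<close> is known only on \<open>[0, 1]\<close>, which
    carries all the mass of \<open>eta_law u\<close>.\<close>
  proof (rule nn_integral_cong_AE)
    show "AE \<eta> in eta_law u. e \<eta> =
        ennreal (g * (\<alpha> * (1 - p) + (1 - \<alpha>) * \<eta>) * indicator {..<t} \<eta>)"
      unfolding eta_law_def
      by (subst AE_density) (auto simp: e indicator_def split: if_splits)
  qed
  also have "\<dots> = (\<integral>\<^sup>+\<eta>. ennreal (eta_density u \<eta> * indicator {0..1} \<eta>) *
      ennreal (g * (\<alpha> * (1 - p) + (1 - \<alpha>) * \<eta>) * indicator {..<t} \<eta>) \<partial>lborel)"
    unfolding eta_law_def by (rule nn_integral_density) auto
  also have "\<dots> = (\<integral>\<^sup>+\<eta>. ennreal (h \<eta>) * indicator {0..t} \<eta> \<partial>lborel)"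
  \<comment> \<open>The event needs \<eta> < \<open>t\<close>, while the fundamental theorem is
    applied on a closed interval; they differ only at the null point \<open>t\<close>.\<close>
  proof (rule nn_integral_cong_AE, rule AE_mp[OF AE_lborel_singleton[of t]], intro AE_I2 impI)
    fix x assume "x \<noteq> t"
    show "ennreal (eta_density u x * indicator {0..1} x) *
        ennreal (g * (\<alpha> * (1 - p) + (1 - \<alpha>) * x) * indicator {..<t} x) =
      ennreal (h x) * indicator {0..t} x"
    proof (cases "0 \<le> x \<and> x < t")
      case True
      then have "ennreal (h x) = ennreal (g * (\<alpha> * (1 - p) + (1 - \<alpha>) * x)) *
          ennreal (u - 4 * (u - 1) * x)"
        unfolding h_def using dens[of x] by (intro ennreal_mult'') simp
      with True show ?thesis
        using t(3) by (simp add: eta_density_def mult.commute)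
    next
      case False
      with \<open>x \<noteq> t\<close> show ?thesis by (auto simp: indicator_def)
    qed
  qed
  also have "\<dots> = ennreal (H t - H 0)"
    using t(2) h_nonneg H_deriv by (intro nn_integral_FTC_Icc) (auto simp: h_def)
  finally have "prob_price_below p \<alpha> g u c = H t - H 0"
    using H_mono by (simp add: prob_price_below_def measure_def)
  then show ?thesis
    by (simp add: H_def)
qed

theorem lemma5:
  fixes p \<alpha> g c u1 u2 :: real
  assumes "0 < p" "p < 1" and "0 < \<alpha>" "\<alpha> < 1" and "0 < g" "g \<le> 1"
    and "0 < c" "c < (1 - \<alpha>) * p / ((1 - \<alpha>) + 4 * \<alpha> * (1 - p))"
    and "u1 \<in> {0..2}" "u2 \<in> {0..2}"
    and "eta_variance u1 < eta_variance u2"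
  shows "prob_price_below p \<alpha> g u1 c < prob_price_below p \<alpha> g u2 c"
proof -
  have u: "u1 < u2"
    using assms by (simp add: eta_variance_eq)
  define t where "t = c * \<alpha> * (1 - p) / ((1 - \<alpha>) * (p - c))"
  have pos: "0 < \<alpha> * (1 - p)" "0 < (1 - \<alpha>)"
    using assms by auto
  \<comment> \<open>Rearranged, this reads
    \<open>4 * c * \<alpha> * (1 - p) < (1 - \<alpha>) * (p - c)\<close>, which yields both
    \<open>c < p\<close> and \<open>t < 1/4\<close>.\<close>
  have bound: "c * ((1 - \<alpha>) + 4 * \<alpha> * (1 - p)) < (1 - \<alpha>) * p"
    using assms pos by (simp add: pos_less_divide_eq add_pos_pos)
  have "0 < c * (\<alpha> * (1 - p))"
    using assms pos by simp
  with bound have gap: "0 < (1 - \<alpha>) * (p - c)"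
    by (simp add: algebra_simps)
  then have c: "c < p"
    using pos by (simp add: zero_less_mult_iff)
  have t: "0 < t" "t < 1/4"
  proof -
    show "0 < t"
      unfolding t_def using gap assms by (intro divide_pos_pos) auto
    show "t < 1/4"
      unfolding t_def using bound by (simp only: pos_divide_less_eq[OF gap]) (simp add: field_simps)
  qed
  \<comment> \<open>By affinity in \<open>u\<close> the difference factors. The brackets in
    \<open>t\<close> are the integrals over \<open>[0, t]\<close> of \<open>1 - 4 * x\<close> and
    \<open>x * (1 - 4 * x)\<close>, both positive for \<open>0 < t < 1/4\<close>.\<close>
  have "prob_price_below p \<alpha> g u2 c - prob_price_below p \<alpha> g u1 c =
      g * (u2 - u1) * (\<alpha> * (1 - p) * (t * (1 - 2 * t)) + (1 - \<alpha>) * (t^2 * (1/2 - 4/3 * t)))"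
  proof -
    have "g * (a * (u2 * t - 2 * (u2 - 1) * t^2) + b * (u2 / 2 * t^2 - 4/3 * (u2 - 1) * t^3)) -
        g * (a * (u1 * t - 2 * (u1 - 1) * t^2) + b * (u1 / 2 * t^2 - 4/3 * (u1 - 1) * t^3)) =
      g * (u2 - u1) * (a * (t * (1 - 2 * t)) + b * (t^2 * (1/2 - 4/3 * t)))" for a b
      by (simp add: power2_eq_square power3_eq_cube field_simps)
    moreover have "prob_price_below p \<alpha> g u c =
        g * (\<alpha> * (1 - p) * (u * t - 2 * (u - 1) * t^2) +
          (1 - \<alpha>) * (u / 2 * t^2 - 4/3 * (u - 1) * t^3))" if "u \<in> {0..2}" for u
      using that assms c t by (intro prob_price_below_eq[OF _ _ _ _ _ _ _ _ _ t_def]) auto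
    ultimately show ?thesis
      using assms(9,10) by (simp only:)
  qed
  also have "\<dots> > 0"
    using assms u pos t by (intro mult_pos_pos add_pos_pos) auto
  finally show ?thesis by simp
qed

end
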